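(* Let $n\ge 2$ and $w\in\mathcal S_n$. The diameter of the commutation graph $C(w)$ (the maximum, over all pairs of vertices, of the graph distance) is equal to $|\mathrm T_w|$, the number of $321$-occurrences in $w$, i.e. the number of triples of values $x<y<z$ such that $z$, $y$, $x$ appear in this order from left to right in the one-line notation of $w$.
   Context: Permutations $w\in\mathcal S_n$ are written in one-line notation $w=w_1\cdots w_n$. A word $a=a_1\cdots a_\ell$ with letters in $\{1,\dots,n-1\}$ acts on a word $u=u_1\cdots u_n$ by successively, for $j=1,\dots,\ell$, swapping the entries in positions $a_j$ and $a_j+1$. The length $\ell(w)$ is the number of inversions of $w$ (pairs of values $q<p$ with $p$ to the left of $q$ in $w$). A reduced word of $w$ is a word of length $\ell(w)$ whose action on $12\cdots n$ yields $w$; $\mathrm R(w)$ is the set of reduced words of $w$. Two reduced words differ by a commutation if one is obtained from the other by replacing a factor $ij$ with $|i-j|\ge 2$ by $ji$; they differ by a long braid relation if one is obtained from the other by replacing a factor $i(i+1)i$ by $(i+1)i(i+1)$ or vice versa. The commutation class $[a]$ of $a\in\mathrm R(w)$ is the set of reduced words obtainable from $a$ by a finite sequence of commutations. The commutation graph $C(w)$ has as vertices the commutation classes of $\mathrm R(w)$, with an edge between $[a]\neq[b]$ whenever some $a'\in[a]$ and $b'\in[b]$ differ by a single long braid relation; $d([a],[b])$ denotes the graph distance in $C(w)$ ($C(w)$ is connected). $\mathrm T_w=\{(x,y,z): x<y<z,\ z,y,x \text{ appear in this order in } w\}$. *)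

theory Defs
  imports Main
begin

text \<open>Permutations of 1..n in one-line notation are lists w of length n with
  set w = {1..n}. Positions in the informal text are 1-based; list indices are 0-based.\<close>

definition is_perm :: "nat \<Rightarrow> nat list \<Rightarrow> bool" where
  "is_perm n w \<longleftrightarrow> length w = n \<and> distinct w \<and> set w = {1..n}"

text \<open>Swap the entries in (1-based) positions i and i+1.\<close>
definition swap_at :: "nat \<Rightarrow> 'a list \<Rightarrow> 'a list" where
  "swap_at i u = u[i - 1 := u ! i, i := u ! (i - 1)]"

definition act :: "nat list \<Rightarrow> 'a list \<Rightarrow> 'a list" where
  "act a u = fold swap_at a u"

definition inv_len :: "nat list \<Rightarrow> nat" where
  "inv_len w = card {(p, q). q < p \<and> (\<exists>i j. i < j \<and> j < length w \<and> w ! i = p \<and> w ! j = q)}"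

definition reduced_words :: "nat \<Rightarrow> nat list \<Rightarrow> nat list set" where
  "reduced_words n w = {a. set a \<subseteq> {1..n-1} \<and> length a = inv_len w \<and> act a [1..<n+1] = w}"

definition commutation :: "(nat list \<times> nat list) set" where
  "commutation = {(xs @ [i, j] @ ys, xs @ [j, i] @ ys) | xs ys i j.
      2 \<le> (if i \<le> j then j - i else i - j)}"

definition long_braid :: "(nat list \<times> nat list) set" where
  "long_braid = {(xs @ [i, Suc i, i] @ ys, xs @ [Suc i, i, Suc i] @ ys) | xs ys i. True}
     \<union> {(xs @ [Suc i, i, Suc i] @ ys, xs @ [i, Suc i, i] @ ys) | xs ys i. True}"

definition comm_class :: "nat \<Rightarrow> nat list \<Rightarrow> nat list \<Rightarrow> nat list set" where
  "comm_class n w a = {b \<in> reduced_words n w. (a, b) \<in> commutation\<^sup>*}"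

definition cg_vertices :: "nat \<Rightarrow> nat list \<Rightarrow> nat list set set" where
  "cg_vertices n w = comm_class n w ` reduced_words n w"

definition cg_edge :: "nat \<Rightarrow> nat list \<Rightarrow> nat list set \<Rightarrow> nat list set \<Rightarrow> bool" where
  "cg_edge n w A B \<longleftrightarrow> A \<in> cg_vertices n w \<and> B \<in> cg_vertices n w \<and> A \<noteq> B \<and>
     (\<exists>a\<in>A. \<exists>b\<in>B. (a, b) \<in> long_braid)"

definition cg_walk :: "nat \<Rightarrow> nat list \<Rightarrow> nat list set list \<Rightarrow> bool" where
  "cg_walk n w ps \<longleftrightarrow> ps \<noteq> [] \<and> set ps \<subseteq> cg_vertices n w \<and>
     (\<forall>k < length ps - 1. cg_edge n w (ps ! k) (ps ! Suc k))"

definition cg_dist :: "nat \<Rightarrow> nat list \<Rightarrow> nat list set \<Rightarrow> nat list set \<Rightarrow> nat" where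
  "cg_dist n w A B = (LEAST k. \<exists>ps. cg_walk n w ps \<and> hd ps = A \<and> last ps = B \<and> length ps = Suc k)"

definition cg_diameter :: "nat \<Rightarrow> nat list \<Rightarrow> nat" where
  "cg_diameter n w = Max {cg_dist n w A B | A B. A \<in> cg_vertices n w \<and> B \<in> cg_vertices n w}"

definition T321 :: "nat list \<Rightarrow> (nat \<times> nat \<times> nat) set" where
  "T321 w = {(x, y, z). x < y \<and> y < z \<and>
     (\<exists>i j k. i < j \<and> j < k \<and> k < length w \<and> w ! i = z \<and> w ! j = y \<and> w ! k = x)}"

end

theory Submission
  imports Defs "HOL-Library.Multiset"
begin

text \<open>Rank a reduced word by the number of 321-triples whose inversions it creates in antilexicographic
  order. Commutations preserve the rank, and a braid relation changes it by exactly one. Moving the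
  largest value first, every reduced word can be brought to one and the same word by commutations
  and rank-lowering braid relations only; this word inserts \<open>1, 2, ..., n\<close> in turn and has rank \<open>0\<close>.
  By the symmetry \<open>v \<mapsto> n + 1 - v\<close> there is likewise a top word, of rank \<open>|T|\<close>, reachable by
  rank-raising moves. Going through the bottom or through the top, two classes of ranks \<open>r\<close> and \<open>s\<close>
  are joined by a path of length \<open>r + s\<close> or \<open>2|T| - r - s\<close>, the smaller of which is at most \<open>|T|\<close>,
  and bottom and top are at distance at least \<open>|T|\<close>.\<close>

section \<open>Adjacent swaps\<close>

lemma swap_at_append [simp]:
  "swap_at (Suc (length xs)) (xs @ x # y # ys) = xs @ y # x # ys"
  by (simp add: swap_at_def nth_append list_update_append)

lemma swap_at_append2 [simp]:
  "swap_at (Suc (Suc (length xs))) (xs @ x # y # z # ys) = xs @ x # z # y # ys"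
  using swap_at_append[of "xs @ [x]" y z ys] by simp

text \<open>Trades an index for a list pattern, so that inductions over words can use the swap rules
  above instead of index arithmetic.\<close>

lemma split_at_two:
  assumes "i \<in> {1..<length u}"
  obtains xs x y ys where "u = xs @ x # y # ys" "i = Suc (length xs)"
proof
  from assms have i: "Suc (i - 1) = i" "i < length u" "i - 1 < length u" by auto
  show "u = take (i - 1) u @ u ! (i - 1) # u ! i # drop (Suc i) u"
    using i by (metis Cons_nth_drop_Suc append_take_drop_id)
  show "i = Suc (length (take (i - 1) u))" using i by simp
qed

lemma split_at_three:
  assumes "i \<in> {1..<length u}" "Suc i \<in> {1..<length u}"
  obtains xs x y z ys where "u = xs @ x # y # z # ys" "i = Suc (length xs)"
proof -
  obtain xs x y ys where u: "u = xs @ x # y # ys" "i = Suc (length xs)"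
    using split_at_two[OF assms(1)] .
  with assms(2) obtain z zs where "ys = z # zs" by (cases ys) auto
  with u that show thesis by blast
qed

lemma length_swap_at [simp]: "length (swap_at i u) = length u"
  by (simp add: swap_at_def)

lemma mset_swap_at: "i \<in> {1..<length u} \<Longrightarrow> mset (swap_at i u) = mset u"
  by (erule split_at_two) auto

lemma act_Nil [simp]: "act [] u = u"
  and act_Cons [simp]: "act (i # a) u = act a (swap_at i u)"
  and act_append [simp]: "act (a @ b) u = act b (act a u)"
  by (simp_all add: act_def)

lemma length_act [simp]: "length (act a u) = length u"
  by (induction a arbitrary: u) auto

lemma mset_act: "set a \<subseteq> {1..<length u} \<Longrightarrow> mset (act a u) = mset u"
  by (induction a arbitrary: u) (auto simp: mset_swap_at)

text \<open>All letters stay below \<open>length u\<close>, so no swap touches \<open>v\<close>.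
  This lets the largest value wait at the right end while the smaller ones are arranged.\<close>

lemma act_append_state:
  "set a \<subseteq> {1..<length u} \<Longrightarrow> act a (u @ v) = act a u @ v"
proof (induction a arbitrary: u)
  case (Cons i a)
  then have "i \<in> {1..<length u}" by simp
  then obtain xs x y ys where "u = xs @ x # y # ys" "i = Suc (length xs)"
    by (rule split_at_two)
  with Cons.prems Cons.IH[of "xs @ y # x # ys"] show ?case by simp
qed simp

section \<open>Ascending words and inversion triples\<close>

text \<open>Every letter must create an inversion. This stepwise condition replaces the global
  length count in the definition of reduced words.\<close>

fun ascending :: "nat list \<Rightarrow> 'a::linorder list \<Rightarrow> bool" where
  "ascending [] u \<longleftrightarrow> True"
| "ascending (i # a) u \<longleftrightarrow> u ! (i - 1) < u ! i \<and> ascending a (swap_at i u)"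

text \<open>The three inversions of a 321-triple \<open>x < y < z\<close> are created either in the order
  \<open>xy, xz, yz\<close> (lex) or in the order \<open>yz, xz, xy\<close> (antilex). A triple is counted at its last
  swap: an antilex triple when \<open>x\<close> and \<open>y\<close> are swapped with \<open>z\<close> already on their left, a lex
  triple when \<open>y\<close> and \<open>z\<close> are swapped with \<open>x\<close> already on their right.\<close>

fun antilex :: "nat list \<Rightarrow> 'a::linorder list \<Rightarrow> nat" where
  "antilex [] u = 0"
| "antilex (i # a) u = length (filter (\<lambda>v. u ! (i - 1) < v \<and> u ! i < v) (take (i - 1) u))
     + antilex a (swap_at i u)"

fun lex_triples :: "nat list \<Rightarrow> 'a::linorder list \<Rightarrow> nat" where
  "lex_triples [] u = 0"
| "lex_triples (i # a) u =
     length (filter (\<lambda>v. v < u ! (i - 1) \<and> v < u ! i) (drop (Suc i) u))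
     + lex_triples a (swap_at i u)"

lemma ascending_append [simp]:
  "ascending (a @ b) u \<longleftrightarrow> ascending a u \<and> ascending b (act a u)"
  by (induction a arbitrary: u) auto

lemma antilex_append [simp]: "antilex (a @ b) u = antilex a u + antilex b (act a u)"
  by (induction a arbitrary: u) auto

lemma ascending_swap [simp]:
  "ascending (Suc (length xs) # a) (xs @ x # y # ys) \<longleftrightarrow> x < y \<and> ascending a (xs @ y # x # ys)"
  by (simp add: nth_append)

lemma ascending_swap2 [simp]:
  "ascending (Suc (Suc (length xs)) # a) (xs @ x # y # z # ys) \<longleftrightarrow>
     y < z \<and> ascending a (xs @ x # z # y # ys)"
  using ascending_swap[of "xs @ [x]" a y z ys] by simp

lemma antilex_swap [simp]:
  "antilex (Suc (length xs) # a) (xs @ x # y # ys) =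
     length (filter (\<lambda>v. x < v \<and> y < v) xs) + antilex a (xs @ y # x # ys)"
  by (simp add: nth_append)

lemma antilex_swap2 [simp]:
  "antilex (Suc (Suc (length xs)) # a) (xs @ x # y # z # ys) =
     length (filter (\<lambda>v. y < v \<and> z < v) (xs @ [x])) + antilex a (xs @ x # z # y # ys)"
  using antilex_swap[of "xs @ [x]" a y z ys] by simp

lemma lex_triples_swap [simp]:
  "lex_triples (Suc (length xs) # a) (xs @ x # y # ys) =
     length (filter (\<lambda>v. v < x \<and> v < y) ys) + lex_triples a (xs @ y # x # ys)"
  by (simp add: nth_append)

declare ascending.simps(2) [simp del] antilex.simps(2) [simp del] lex_triples.simps(2) [simp del]

lemma ascending_append_state:
  "set a \<subseteq> {1..<length u} \<Longrightarrow> ascending a (u @ v) = ascending a u"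
proof (induction a arbitrary: u)
  case (Cons i a)
  then have "i \<in> {1..<length u}" by simp
  then obtain xs x y ys where "u = xs @ x # y # ys" "i = Suc (length xs)"
    by (rule split_at_two)
  with Cons.prems Cons.IH[of "xs @ y # x # ys"] show ?case by simp
qed simp

text \<open>\<open>antilex\<close> looks only to the left of a swap. The analogue for
  \<open>lex_triples\<close>, which looks to the right, fails for general \<open>v\<close>.\<close>

lemma antilex_append_state:
  "set a \<subseteq> {1..<length u} \<Longrightarrow> antilex a (u @ v) = antilex a u"
proof (induction a arbitrary: u)
  case (Cons i a)
  then have "i \<in> {1..<length u}" by simp
  then obtain xs x y ys where "u = xs @ x # y # ys" "i = Suc (length xs)"
    by (rule split_at_two)
  with Cons.prems Cons.IH[of "xs @ y # x # ys"] show ?case by simp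
qed simp

section \<open>Inversions and 321-occurrences under a swap\<close>

text \<open>The positional condition in \<open>inv_len\<close>, isolated so that recursion rules on
  lists can replace positions; \<open>before3\<close> does the same for \<open>T321\<close>.\<close>

definition before :: "'a list \<Rightarrow> 'a \<Rightarrow> 'a \<Rightarrow> bool" where
  "before u p q \<longleftrightarrow> (\<exists>i j. i < j \<and> j < length u \<and> u ! i = p \<and> u ! j = q)"

definition before3 :: "'a list \<Rightarrow> 'a \<Rightarrow> 'a \<Rightarrow> 'a \<Rightarrow> bool" where
  "before3 u p q r \<longleftrightarrow>
     (\<exists>i j k. i < j \<and> j < k \<and> k < length u \<and> u ! i = p \<and> u ! j = q \<and> u ! k = r)"

section \<open>Recursion rules for the relative order of entries\<close>

lemma before_Nil [simp]: "\<not> before [] p q"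
  by (simp add: before_def)

lemma before3_Nil [simp]: "\<not> before3 [] p q r"
  by (simp add: before3_def)

lemma before_Cons [simp]: "before (x # u) p q \<longleftrightarrow> (p = x \<and> q \<in> set u) \<or> before u p q"
proof
  assume "before (x # u) p q"
  then obtain i j where *: "i < j" "j < Suc (length u)" "(x # u) ! i = p" "(x # u) ! j = q"
    by (auto simp: before_def)
  then obtain j' where j: "j = Suc j'" by (cases j) auto
  show "(p = x \<and> q \<in> set u) \<or> before u p q"
    using * j by (cases i) (auto simp: before_def)
next
  assume "(p = x \<and> q \<in> set u) \<or> before u p q"
  then show "before (x # u) p q"
  proof
    assume "p = x \<and> q \<in> set u"
    then obtain j where "j < length u" "u ! j = q" "p = x" by (auto simp: in_set_conv_nth)
    then show ?thesis unfolding before_def by (intro exI[of _ 0] exI[of _ "Suc j"]) auto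
  next
    assume "before u p q"
    then obtain i j where "i < j" "j < length u" "u ! i = p" "u ! j = q"
      by (auto simp: before_def)
    then show ?thesis unfolding before_def by (intro exI[of _ "Suc i"] exI[of _ "Suc j"]) auto
  qed
qed

lemma before3_Cons [simp]: "before3 (x # u) p q r \<longleftrightarrow> (p = x \<and> before u q r) \<or> before3 u p q r"
proof
  assume "before3 (x # u) p q r"
  then obtain i j k where *: "i < j" "j < k" "k < Suc (length u)"
    "(x # u) ! i = p" "(x # u) ! j = q" "(x # u) ! k = r"
    by (auto simp: before3_def)
  then obtain j' k' where j: "j = Suc j'" "k = Suc k'" by (cases j; cases k) auto
  show "(p = x \<and> before u q r) \<or> before3 u p q r"
    using * j by (cases i) (auto simp: before_def before3_def)
next
  assume "(p = x \<and> before u q r) \<or> before3 u p q r"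
  then show "before3 (x # u) p q r"
  proof
    assume "p = x \<and> before u q r"
    then obtain j k where "j < k" "k < length u" "u ! j = q" "u ! k = r" "p = x"
      by (auto simp: before_def)
    then show ?thesis unfolding before3_def
      by (intro exI[of _ 0] exI[of _ "Suc j"] exI[of _ "Suc k"]) auto
  next
    assume "before3 u p q r"
    then obtain i j k where "i < j" "j < k" "k < length u" "u ! i = p" "u ! j = q" "u ! k = r"
      by (auto simp: before3_def)
    then show ?thesis unfolding before3_def
      by (intro exI[of _ "Suc i"] exI[of _ "Suc j"] exI[of _ "Suc k"]) auto
  qed
qed

lemma before_set: "before u p q \<Longrightarrow> p \<in> set u \<and> q \<in> set u"
  by (induction u) auto

lemma before3_set: "before3 u p q r \<Longrightarrow> p \<in> set u \<and> q \<in> set u \<and> r \<in> set u"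
  by (induction u) (auto dest: before_set)

lemma before_append [simp]:
  "before (u @ v) p q \<longleftrightarrow> before u p q \<or> before v p q \<or> p \<in> set u \<and> q \<in> set v"
  by (induction u) auto

lemma before3_append [simp]:
  "before3 (u @ v) p q r \<longleftrightarrow> before3 u p q r \<or> before3 v p q r
     \<or> before u p q \<and> r \<in> set v \<or> p \<in> set u \<and> before v q r"
  by (induction u) auto

section \<open>Counting inversions and 321-occurrences\<close>

lemma inv_len_before: "inv_len u = card {(p, q). q < p \<and> before u p q}"
  by (simp add: inv_len_def before_def)

lemma T321_before3: "T321 u = {(x, y, z). x < y \<and> y < z \<and> before3 u z y x}"
  by (simp add: T321_def before3_def)

lemma finite_inversions: "finite {(p, q). q < p \<and> before u p q}"
  by (rule finite_subset[of _ "set u \<times> set u"]) (auto dest: before_set)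

lemma finite_T321: "finite (T321 u)"
  by (rule finite_subset[of _ "set u \<times> set u \<times> set u"])
    (auto simp: T321_before3 dest: before3_set)

text \<open>Only the relative order of \<open>x\<close> and \<open>y\<close> changes, so
  \<open>(y, x)\<close> is the one new inversion and none is lost.\<close>

lemma inv_len_swap:
  fixes x y :: nat
  assumes "distinct (xs @ x # y # ys)" "x < y"
  shows "inv_len (xs @ y # x # ys) = Suc (inv_len (xs @ x # y # ys))"
proof -
  let ?I = "\<lambda>u. {(p, q). q < p \<and> before u p q}"
  have eq: "?I (xs @ y # x # ys) = insert (y, x) (?I (xs @ x # y # ys))"
    using assms by auto
  have "(y, x) \<notin> ?I (xs @ x # y # ys)"
    using assms by (auto dest: before_set)
  then show ?thesis
    unfolding inv_len_before eq by (rule card_insert_disjoint[OF finite_inversions])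
qed

text \<open>A new occurrence must use the new inversion of \<open>y\<close> and \<open>x\<close>.
  Its third value is either larger than \<open>y\<close> and in \<open>xs\<close>, or smaller than
  \<open>x\<close> and in \<open>ys\<close>.\<close>

lemma card_T321_swap:
  fixes x y :: nat
  assumes d: "distinct (xs @ x # y # ys)" and "x < y"
  shows "card (T321 (xs @ y # x # ys)) = card (T321 (xs @ x # y # ys))
    + length (filter (\<lambda>v. y < v) xs) + length (filter (\<lambda>v. v < x) ys)"
proof -
  let ?A = "T321 (xs @ x # y # ys)"
  let ?B = "(\<lambda>v. (x, y, v)) ` set (filter (\<lambda>v. y < v) xs)"
  let ?C = "(\<lambda>v. (v, x, y)) ` set (filter (\<lambda>v. v < x) ys)"
  have eq: "T321 (xs @ y # x # ys) = ?A \<union> ?B \<union> ?C"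
    using \<open>x < y\<close> unfolding T321_before3 by auto
  have dis: "?A \<inter> ?B = {}" "(?A \<union> ?B) \<inter> ?C = {}"
    using assms unfolding T321_before3 by (auto dest: before_set before3_set)
  have B: "card ?B = length (filter (\<lambda>v. y < v) xs)"
    using d by (subst card_image) (auto simp: inj_on_def distinct_card[symmetric] simp del: set_filter)
  have C: "card ?C = length (filter (\<lambda>v. v < x) ys)"
    using d by (subst card_image) (auto simp: inj_on_def distinct_card[symmetric] simp del: set_filter)
  have "card (?A \<union> ?B \<union> ?C) = card ?A + card ?B + card ?C"
    using dis by (simp add: card_Un_disjoint finite_T321 del: set_filter)
  then show ?thesis unfolding eq B C .
qed

text \<open>Each letter changes the number of inversions by plus or minus one, so the bound is
  attained exactly when every letter ascends. Both claims go through one induction: after a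
  descending swap, the bound for the remaining letters rules out equality.\<close>

lemma inv_len_act:
  fixes u :: "nat list"
  assumes "distinct u" "set a \<subseteq> {1..<length u}"
  shows "inv_len (act a u) \<le> inv_len u + length a"
    and "inv_len (act a u) = inv_len u + length a \<longleftrightarrow> ascending a u"
proof -
  have "inv_len (act a u) \<le> inv_len u + length a \<and>
    (inv_len (act a u) = inv_len u + length a \<longleftrightarrow> ascending a u)"
    using assms
  proof (induction a arbitrary: u)
    case (Cons i a)
    then have "i \<in> {1..<length u}" by simp
    then obtain xs x y ys where u: "u = xs @ x # y # ys" "i = Suc (length xs)"
      by (rule split_at_two)
    have IH: "inv_len (act a (xs @ y # x # ys)) \<le> inv_len (xs @ y # x # ys) + length a"
      "inv_len (act a (xs @ y # x # ys)) = inv_len (xs @ y # x # ys) + length a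
        \<longleftrightarrow> ascending a (xs @ y # x # ys)"
      using Cons.IH[of "xs @ y # x # ys"] Cons.prems u by auto
    consider "x < y" | "y < x" using Cons.prems(1) u by force
    then show ?case
    proof cases
      case 1
      have "inv_len (xs @ y # x # ys) = Suc (inv_len (xs @ x # y # ys))"
        using inv_len_swap[OF _ 1] Cons.prems(1) u by blast
      then show ?thesis using IH u 1 by auto
    next
      case 2
      have "inv_len (xs @ x # y # ys) = Suc (inv_len (xs @ y # x # ys))"
        using Cons.prems(1) u by (intro inv_len_swap[OF _ 2]) auto
      then show ?thesis using IH u 2 by auto
    qed
  qed simp
  then show "inv_len (act a u) \<le> inv_len u + length a"
    and "inv_len (act a u) = inv_len u + length a \<longleftrightarrow> ascending a u" by auto
qed

text \<open>Each occurrence is completed by exactly one swap: \<open>antilex\<close> counts it if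
  its third value is the largest, \<open>lex_triples\<close> if it is the smallest.\<close>

lemma card_T321_act:
  fixes u :: "nat list"
  assumes "distinct u" "set a \<subseteq> {1..<length u}" "ascending a u"
  shows "card (T321 (act a u)) = card (T321 u) + antilex a u + lex_triples a u"
  using assms
proof (induction a arbitrary: u)
  case (Cons i a)
  then have "i \<in> {1..<length u}" by simp
  then obtain xs x y ys where u: "u = xs @ x # y # ys" "i = Suc (length xs)"
    by (rule split_at_two)
  have "x < y" using Cons.prems u by simp
  then have "(\<lambda>v. x < v \<and> y < v) = (\<lambda>v. y < v)" "(\<lambda>v. v < x \<and> v < y) = (\<lambda>v. v < x)"
    by auto
  moreover have "card (T321 (act a (xs @ y # x # ys))) = card (T321 (xs @ y # x # ys))
      + antilex a (xs @ y # x # ys) + lex_triples a (xs @ y # x # ys)"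
    using Cons u by auto
  ultimately show ?case
    using card_T321_swap[of xs x y ys] Cons.prems u by simp
qed simp

section \<open>The identity permutation and reduced words\<close>

lemma before_sorted: "sorted_wrt (<) u \<Longrightarrow> before u p q \<Longrightarrow> (p::nat) < q"
  by (induction u) auto

lemma before3_before: "before3 u p q r \<Longrightarrow> before u p q"
  by (induction u) (auto dest: before_set)

lemma inv_len_upt [simp]: "inv_len [m..<n] = 0"
proof -
  have "{(p, q). q < p \<and> before [m..<n] p q} = {}"
    using before_sorted[OF sorted_wrt_upt, of m n] by force
  then show ?thesis unfolding inv_len_before by (simp only: card.empty)
qed

lemma T321_upt [simp]: "T321 [m..<n] = {}"
  unfolding T321_before3 using before_sorted[OF sorted_wrt_upt, of m n]
  by (force dest: before3_before)

text \<open>The identity has no inversions, so a word has length \<open>inv_len w\<close> exactly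
  when each of its letters adds one.\<close>

lemma reduced_words_iff:
  "a \<in> reduced_words n w \<longleftrightarrow>
     set a \<subseteq> {1..<n} \<and> ascending a [1..<Suc n] \<and> act a [1..<Suc n] = w"
proof -
  have "{1..n - 1} = {1..<n}" by (cases n) auto
  then show ?thesis
    using inv_len_act(2)[of "[1..<Suc n]" a] inv_len_upt[of 1 "Suc n"]
    by (auto simp: reduced_words_def simp del: inv_len_upt upt_Suc)
qed

section \<open>Moves between words\<close>

text \<open>The long braid relation, oriented in the direction that lowers
  \<open>antilex\<close>.\<close>

definition braid_down :: "(nat list \<times> nat list) set" where
  "braid_down = {(xs @ [Suc i, i, Suc i] @ ys, xs @ [i, Suc i, i] @ ys) | xs ys i. True}"

abbreviation down_moves :: "(nat list \<times> nat list) set" where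
  "down_moves \<equiv> commutation \<union> braid_down"

abbreviation far :: "nat \<Rightarrow> nat \<Rightarrow> bool" where
  "far i j \<equiv> 2 \<le> (if i \<le> j then j - i else i - j)"

lemma long_braid_iff: "(a, b) \<in> long_braid \<longleftrightarrow> (a, b) \<in> braid_down \<or> (b, a) \<in> braid_down"
  unfolding long_braid_def braid_down_def by blast

lemma commutationE:
  assumes "(a, b) \<in> commutation"
  obtains xs i j ys where "a = xs @ i # j # ys" "b = xs @ j # i # ys" "far i j"
  using assms unfolding commutation_def by auto

lemma braid_downE:
  assumes "(a, b) \<in> braid_down"
  obtains xs i ys where "a = xs @ Suc i # i # Suc i # ys" "b = xs @ i # Suc i # i # ys"
  using assms unfolding braid_down_def by auto

lemma commutation_sym: "(a, b) \<in> commutation \<Longrightarrow> (b, a) \<in> commutation"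
  unfolding commutation_def by (force split: if_splits)

lemma commutation_swap:
  "far i j \<Longrightarrow> (xs @ i # j # ys, xs @ j # i # ys) \<in> commutation"
  unfolding commutation_def by force

lemma braid_down_append:
  "(a, b) \<in> braid_down \<Longrightarrow> (p @ a @ q, p @ b @ q) \<in> braid_down"
proof (erule braid_downE)
  fix xs i ys
  assume "a = xs @ Suc i # i # Suc i # ys" "b = xs @ i # Suc i # i # ys"
  then have "p @ a @ q = (p @ xs) @ [Suc i, i, Suc i] @ (ys @ q)"
    "p @ b @ q = (p @ xs) @ [i, Suc i, i] @ (ys @ q)" by auto
  then show ?thesis unfolding braid_down_def by blast
qed

lemma commutation_append:
  "(a, b) \<in> commutation \<Longrightarrow> (p @ a @ q, p @ b @ q) \<in> commutation"
proof (erule commutationE)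
  fix xs i j ys
  assume "a = xs @ i # j # ys" "b = xs @ j # i # ys" "far i j"
  then show ?thesis using commutation_swap[of i j "p @ xs" "ys @ q"] by simp
qed

lemma rtrancl_context:
  assumes "\<And>a b. (a, b) \<in> r \<Longrightarrow> (p @ a @ q, p @ b @ q) \<in> r" and "(a, b) \<in> r\<^sup>*"
  shows "(p @ a @ q, p @ b @ q) \<in> r\<^sup>*"
  using assms(2)
proof (induction rule: rtrancl_induct)
  case (step b c)
  with assms(1) show ?case by (meson rtrancl.rtrancl_into_rtrancl)
qed simp

lemma down_moves_append:
  "(a, b) \<in> down_moves\<^sup>* \<Longrightarrow> (p @ a @ q, p @ b @ q) \<in> down_moves\<^sup>*"
  by (rule rtrancl_context) (use braid_down_append commutation_append in blast)+

lemma commute_through: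
  "\<forall>k\<in>set c. far k j \<Longrightarrow> (c @ [j], j # c) \<in> commutation\<^sup>*"
proof (induction c)
  case (Cons k c)
  have "(k # c @ [j], k # j # c) \<in> commutation\<^sup>*"
    using Cons rtrancl_context[of commutation "[k]" "[]", OF commutation_append] by simp
  moreover have "(k # j # c, j # k # c) \<in> commutation"
    using Cons.prems commutation_swap[of k j "[]" c] by simp
  ultimately show ?case by simp
qed simp

text \<open>Far letters swap disjoint pairs. The left swap merely permutes the entries to the left
  of the right pair, so the number of larger entries seen there does not depend on the
  order.\<close>

lemma commutation_word:
  assumes "(a, b) \<in> commutation" "set a \<subseteq> {1..<length u}"
  shows "set b = set a" "act b u = act a u" "ascending b u = ascending a u"
    "antilex b u = antilex a u"
proof -
  have aux: "act (j # i # ys) v = act (i # j # ys) v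
      \<and> ascending (j # i # ys) v = ascending (i # j # ys) v
      \<and> antilex (j # i # ys) v = antilex (i # j # ys) v"
    if ij: "Suc i < j" "i \<in> {1..<length v}" "j \<in> {1..<length v}"
    for i j ys and v :: "'a list"
  proof -
    obtain xs x y zs where v: "v = xs @ x # y # zs" "i = Suc (length xs)"
      using split_at_two[OF ij(2)] .
    \<comment> \<open>\<open>zs\<close> starts at position \<open>i + 2\<close> of \<open>v\<close>,
      so position \<open>j\<close> of \<open>v\<close> is position \<open>j - Suc i\<close> of
      \<open>zs\<close>.\<close>
    have "j - Suc i \<in> {1..<length zs}" using ij v by auto
    then obtain ps p q qs where z: "zs = ps @ p # q # qs" "j - Suc i = Suc (length ps)"
      by (rule split_at_two)
    have j: "j = Suc (length (xs @ x # y # ps))" "j = Suc (length (xs @ y # x # ps))"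
      using z v ij by auto
    have v': "v = (xs @ x # y # ps) @ p # q # qs" using v z by simp
    have 1: "swap_at j v = xs @ x # y # (ps @ q # p # qs)"
      unfolding v' j(1) swap_at_append by simp
    have 2: "swap_at i v = (xs @ y # x # ps) @ p # q # qs"
      unfolding v z by simp
    have 3: "swap_at j (swap_at i v) = xs @ y # x # ps @ q # p # qs"
      unfolding 2 j(2) swap_at_append by simp
    have 4: "swap_at i (swap_at j v) = xs @ y # x # ps @ q # p # qs"
      unfolding 1 v(2) by simp
    have F1: "ascending (j # c) v = (p < q \<and> ascending c (swap_at j v))"
      "antilex (j # c) v = length (filter (\<lambda>v. p < v \<and> q < v) (xs @ x # y # ps))
        + antilex c (swap_at j v)" for c
      unfolding v' j(1) swap_at_append ascending_swap antilex_swap by (rule refl)+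
    have F2: "ascending (j # c) (swap_at i v) =
        (p < q \<and> ascending c (swap_at j (swap_at i v)))"
      "antilex (j # c) (swap_at i v) = length (filter (\<lambda>v. p < v \<and> q < v) (xs @ y # x # ps))
        + antilex c (swap_at j (swap_at i v))" for c
      unfolding 2 j(2) swap_at_append ascending_swap antilex_swap by (rule refl)+
    have F3: "ascending (i # c) v = (x < y \<and> ascending c (swap_at i v))"
      "antilex (i # c) v = length (filter (\<lambda>v. x < v \<and> y < v) xs) + antilex c (swap_at i v)" for c
      unfolding v swap_at_append ascending_swap antilex_swap by (rule refl)+
    have F4: "ascending (i # c) (swap_at j v) =
        (x < y \<and> ascending c (swap_at i (swap_at j v)))"
      "antilex (i # c) (swap_at j v) = length (filter (\<lambda>v. x < v \<and> y < v) xs)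
        + antilex c (swap_at i (swap_at j v))" for c
      unfolding 1 v(2) swap_at_append ascending_swap antilex_swap by (rule refl)+
    show ?thesis
      by (simp add: F1 F2 F3 F4 3 4 conj_ac)
  qed
  obtain xs i j ys where ab: "a = xs @ i # j # ys" "b = xs @ j # i # ys" "far i j"
    using commutationE[OF assms(1)] .
  then show "set b = set a" by auto
  have r: "i \<in> {1..<length (act xs u)}" "j \<in> {1..<length (act xs u)}"
    using assms(2) ab by auto
  have "Suc i < j \<or> Suc j < i" using ab(3) by (auto split: if_splits)
  then have *: "act (j # i # ys) (act xs u) = act (i # j # ys) (act xs u)
      \<and> ascending (j # i # ys) (act xs u) = ascending (i # j # ys) (act xs u)
      \<and> antilex (j # i # ys) (act xs u) = antilex (i # j # ys) (act xs u)"
  proof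
    assume "Suc i < j"
    from aux[OF this r] show ?thesis .
  next
    assume "Suc j < i"
    from aux[OF this r(2,1)] show ?thesis by metis
  qed
  show "act b u = act a u" "ascending b u = ascending a u" "antilex b u = antilex a u"
    unfolding ab act_append ascending_append antilex_append using * by metis+
qed

text \<open>Both sides reverse three consecutive entries \<open>x\<close>, \<open>y\<close>,
  \<open>z\<close>. Entries further left contribute equally; the difference of one arises because
  \<open>a\<close> swaps \<open>x\<close> and \<open>y\<close> last, with the larger
  \<open>z\<close> already on their left.\<close>

lemma braid_down_word:
  assumes "(a, b) \<in> braid_down" "set a \<subseteq> {1..<length u}"
  shows "set b = set a" "act b u = act a u" "ascending b u = ascending a u"
    "ascending a u \<Longrightarrow> antilex a u = Suc (antilex b u)"
proof -
  obtain xs i ys where ab: "a = xs @ Suc i # i # Suc i # ys" "b = xs @ i # Suc i # i # ys"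
    using braid_downE[OF assms(1)] .
  then show "set b = set a" by auto
  have "i \<in> {1..<length (act xs u)}" "Suc i \<in> {1..<length (act xs u)}"
    using assms(2) ab by auto
  then obtain ps x y z qs where v: "act xs u = ps @ x # y # z # qs" "i = Suc (length ps)"
    by (rule split_at_three)
  show "act b u = act a u" unfolding ab by (simp add: v)
  show "ascending b u = ascending a u" unfolding ab by (auto simp: v)
  show "antilex a u = Suc (antilex b u)" if "ascending a u"
  proof -
    from that have "x < y" "y < z" "x < z" unfolding ab by (auto simp: v)
    then show ?thesis unfolding ab
      by (auto simp: v intro!: arg_cong[of _ _ length] filter_cong)
  qed
qed

lemma down_moves_word:
  assumes "(a, b) \<in> down_moves\<^sup>*" "set a \<subseteq> {1..<length u}"
  shows "set b = set a" "act b u = act a u" "ascending b u = ascending a u"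
proof -
  from assms(1) have "set b = set a \<and> act b u = act a u \<and> ascending b u = ascending a u"
  proof (induction rule: rtrancl_induct)
    case (step b c)
    from step.hyps(2) show ?case
    proof
      assume "(b, c) \<in> commutation"
      from commutation_word[OF this, of u] show ?thesis using step.IH assms(2) by simp
    next
      assume "(b, c) \<in> braid_down"
      from braid_down_word[OF this, of u] show ?thesis using step.IH assms(2) by simp
    qed
  qed simp
  then show "set b = set a" "act b u = act a u" "ascending b u = ascending a u" by auto
qed

section \<open>Normal forms\<close>

text \<open>The letter \<open>j\<close> commutes left past all letters below \<open>j - 1\<close>
  and meets \<open>j\<close> and \<open>j - 1\<close>. One downward braid turns this into
  \<open>j - 1\<close>, \<open>j\<close>, \<open>j - 1\<close>, and the first of these commutes past
  all letters above \<open>j\<close>.\<close>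

lemma braid_through:
  assumes "p < j" "j < n"
  shows "(rev [p..<n] @ [j], (j - 1) # rev [p..<n]) \<in> down_moves\<^sup>*"
proof -
  obtain i where j: "j = Suc i" using assms by (cases j) auto
  have c: "commutation\<^sup>* \<subseteq> down_moves\<^sup>*" by (rule rtrancl_mono) auto
  let ?A = "rev [Suc j..<n]" and ?B = "rev [p..<i]"
  have "[p..<n] = [p..<i] @ [i..<n]" using assms j upt_add_eq_append[of p i "n - i"] by simp
  also have "[i..<n] = i # j # [Suc j..<n]" using assms j by (simp add: upt_conv_Cons)
  finally have split: "rev [p..<n] = ?A @ [j, i] @ ?B" by simp
  have "(?B @ [j], [j] @ ?B) \<in> commutation\<^sup>*"
    using j commute_through[of ?B j] by force
  then have 1: "((?A @ [j, i]) @ (?B @ [j]) @ [], (?A @ [j, i]) @ ([j] @ ?B) @ []) \<in> down_moves\<^sup>*"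
    using c by (intro down_moves_append) auto
  have 2: "(?A @ [Suc i, i, Suc i] @ ?B, ?A @ [i, Suc i, i] @ ?B) \<in> down_moves"
    unfolding braid_down_def by blast
  have "(?A @ [i], [i] @ ?A) \<in> commutation\<^sup>*"
    using j commute_through[of ?A i] by force
  then have 3: "([] @ (?A @ [i]) @ ([j, i] @ ?B), [] @ ([i] @ ?A) @ ([j, i] @ ?B)) \<in> down_moves\<^sup>*"
    using c by (intro down_moves_append) auto
  from rtrancl_trans[OF _ 3] rtrancl_into_rtrancl[OF 1] 2
  show ?thesis unfolding split using j by simp
qed

text \<open>The decreasing word carries \<open>m\<close> leftwards across \<open>ys\<close>. It
  crosses the last entry of \<open>ys\<close> first, hence the induction from that end.\<close>

lemma act_rev_upt:
  "act (rev [Suc (length xs)..<Suc (length xs + length ys)]) (xs @ ys @ m # zs) = xs @ m # ys @ zs"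
proof (induction ys arbitrary: zs rule: rev_induct)
  case (snoc y ys)
  have "swap_at (Suc (length (xs @ ys))) ((xs @ ys) @ y # m # zs) = (xs @ ys) @ m # y # zs"
    by (rule swap_at_append)
  then show ?case using snoc[of "y # zs"] by simp
qed simp

lemma ascending_rev_upt:
  "\<forall>y\<in>set ys. y < m \<Longrightarrow>
    ascending (rev [Suc (length xs)..<Suc (length xs + length ys)]) (xs @ ys @ m # zs)"
proof (induction ys arbitrary: zs rule: rev_induct)
  case (snoc y ys)
  have "ascending (Suc (length (xs @ ys)) # a) ((xs @ ys) @ y # m # zs)
     \<longleftrightarrow> y < m \<and> ascending a ((xs @ ys) @ m # y # zs)" for a
    by (rule ascending_swap)
  then show ?case using snoc.IH[of "y # zs"] snoc.prems by simp
qed simp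

text \<open>Every swap involves \<open>m\<close>, and no entry to its left exceeds
  \<open>m\<close>.\<close>

lemma antilex_rev_upt:
  "\<forall>y\<in>set xs \<union> set ys. y \<le> m \<Longrightarrow>
    antilex (rev [Suc (length xs)..<Suc (length xs + length ys)]) (xs @ ys @ m # zs) = 0"
proof (induction ys arbitrary: zs rule: rev_induct)
  case (snoc y ys)
  have "antilex (Suc (length (xs @ ys)) # a) ((xs @ ys) @ y # m # zs) =
     length (filter (\<lambda>v. y < v \<and> m < v) (xs @ ys)) + antilex a ((xs @ ys) @ m # y # zs)" for a
    by (rule antilex_swap)
  moreover have "filter (\<lambda>v. y < v \<and> m < v) (xs @ ys) = []"
    using snoc.prems by (force simp: filter_empty_conv)
  ultimately show ?case using snoc.IH[of "y # zs"] snoc.prems by simp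
qed simp

declare upt_Suc [simp del] One_nat_def [simp del]

section \<open>Separating the moves of the largest value\<close>

lemma upt_1_snoc: "[1..<Suc (Suc n)] = [1..<Suc n] @ [Suc n]"
  by (simp add: upt_Suc_append)

text \<open>While \<open>b\<close> acts, \<open>Suc n\<close> stays at the right end; the decreasing
  word then carries it to position \<open>p\<close>.\<close>

lemma act_insert_largest:
  assumes "set b \<subseteq> {1..<n}" "p \<in> {1..Suc n}"
  obtains xs ys where "act b [1..<Suc n] = xs @ ys" "p = Suc (length xs)"
    "n = length xs + length ys" "act (b @ rev [p..<Suc n]) [1..<Suc (Suc n)] = xs @ Suc n # ys"
proof
  let ?u = "act b [1..<Suc n]"
  show u: "?u = take (p - 1) ?u @ drop (p - 1) ?u" by simp
  show p: "p = Suc (length (take (p - 1) ?u))" using assms(2) by auto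
  show l: "n = length (take (p - 1) ?u) + length (drop (p - 1) ?u)" using assms(2) by auto
  have "act b [1..<Suc (Suc n)] = ?u @ [Suc n]"
    using assms(1) act_append_state[of b "[1..<Suc n]" "[Suc n]"]
    by (simp add: upt_1_snoc)
  moreover have "act (rev [p..<Suc n]) (?u @ [Suc n]) = take (p - 1) ?u @ Suc n # drop (p - 1) ?u"
    using act_rev_upt[of "take (p - 1) ?u" "drop (p - 1) ?u" "Suc n" "[]"]
    unfolding p[symmetric] l[symmetric] append_assoc[symmetric] u[symmetric] by simp
  ultimately show "act (b @ rev [p..<Suc n]) [1..<Suc (Suc n)] =
      take (p - 1) ?u @ Suc n # drop (p - 1) ?u" by simp
qed

text \<open>The largest value travels only to the left. A later letter on its left commutes with all of
  its swaps, a later letter on its right passes through them at the cost of one downward braid.\<close>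

lemma normalize_largest:
  assumes "set a \<subseteq> {1..<Suc n}" "ascending a [1..<Suc (Suc n)]"
  shows "\<exists>b p. set b \<subseteq> {1..<n} \<and> p \<in> {1..Suc n} \<and> (a, b @ rev [p..<Suc n]) \<in> down_moves\<^sup>*"
  using assms
proof (induction a rule: rev_induct)
  case Nil
  \<comment> \<open>For \<open>p = Suc n\<close> the decreasing word is empty: the largest value has
    not moved.\<close>
  show ?case by (rule exI[of _ "[]"], rule exI[of _ "Suc n"]) simp
next
  case (snoc j a)
  then obtain b p where b: "set b \<subseteq> {1..<n}" "p \<in> {1..Suc n}"
    "(a, b @ rev [p..<Suc n]) \<in> down_moves\<^sup>*" by auto
  have step: "(a @ [j], b @ rev [p..<Suc n] @ [j]) \<in> down_moves\<^sup>*"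
    using down_moves_append[OF b(3), of "[]" "[j]"] by simp
  have c: "commutation\<^sup>* \<subseteq> down_moves\<^sup>*" by (rule rtrancl_mono) auto
  have j: "1 \<le> j" "j < Suc n" using snoc.prems by auto
  \<comment> \<open>The largest value stands at position \<open>p\<close>. The letter
    \<open>j\<close> acts to its left, moves it left, would move it right, or acts to its
    right.\<close>
  consider "Suc j < p" | "Suc j = p" | "j = p" | "p < j" by linarith
  then show ?case
  proof cases
    case 1
    then have "(rev [p..<Suc n] @ [j], j # rev [p..<Suc n]) \<in> commutation\<^sup>*"
      by (intro commute_through) auto
    then have "(rev [p..<Suc n] @ [j], j # rev [p..<Suc n]) \<in> down_moves\<^sup>*" using c by blast
    from down_moves_append[OF this, of b "[]"] step
    have "(a @ [j], (b @ [j]) @ rev [p..<Suc n]) \<in> down_moves\<^sup>*"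
      by simp
    moreover have "set (b @ [j]) \<subseteq> {1..<n}" using b 1 j by auto
    ultimately show ?thesis using b by blast
  next
    case 2
    then have "rev [j..<Suc n] = rev [p..<Suc n] @ [j]" using j by (simp add: upt_conv_Cons)
    then have "(a @ [j], b @ rev [j..<Suc n]) \<in> down_moves\<^sup>*" using step by simp
    moreover have "j \<in> {1..Suc n}" using j by auto
    ultimately show ?thesis using b by blast
  next
    case 3
    have set_a: "set a \<subseteq> {1..<length [1..<Suc (Suc n)]}" using snoc.prems by simp
    let ?id = "[1..<Suc (Suc n)]"
    obtain xs ys where xy: "act b [1..<Suc n] = xs @ ys" "p = Suc (length xs)"
      "n = length xs + length ys" "act (b @ rev [p..<Suc n]) ?id = xs @ Suc n # ys"
      using act_insert_largest[OF b(1,2)] .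
    have act_a: "act a ?id = xs @ Suc n # ys"
      using down_moves_word(2)[OF b(3) set_a] xy(4) by simp
    from 3 j xy obtain y zs where ys: "ys = y # zs" by (cases ys) auto
    have "set (act a ?id) = set ?id" using mset_act[OF set_a] mset_eq_setD by blast
    then have "y < Suc (Suc n)" using act_a ys by force
    \<comment> \<open>Swapping the largest value with its right neighbour \<open>y\<close> would be
      a descent.\<close>
    moreover have "ascending [j] (act a ?id)" using snoc.prems(2) by simp
    then have "Suc n < y" unfolding act_a 3 xy(2) ys by simp
    ultimately have False by simp
    then show ?thesis ..
  next
    case 4
    \<comment> \<open>Before the largest value is inserted, the entries to the right of position
      \<open>p\<close> sit one place further left; hence the letter \<open>j - 1\<close>.\<close>
    from down_moves_append[OF braid_through[OF 4 j(2)], of b "[]"] step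
    have "(a @ [j], (b @ [j - 1]) @ rev [p..<Suc n]) \<in> down_moves\<^sup>*"
      by simp
    moreover have "set (b @ [j - 1]) \<subseteq> {1..<n}" using b 4 j by auto
    ultimately show ?thesis using b by blast
  qed
qed

text \<open>Delete the largest value, build the rest, then carry that value from the right end to
  its place. The result depends on \<open>w\<close> alone, which makes it a common endpoint for all
  reduced words.\<close>

fun canonical_word :: "nat \<Rightarrow> nat list \<Rightarrow> nat list" where
  "canonical_word 0 w = []"
| "canonical_word (Suc n) w =
     (let xs = takeWhile (\<lambda>v. v \<noteq> Suc n) w; ys = tl (dropWhile (\<lambda>v. v \<noteq> Suc n) w)
      in canonical_word n (xs @ ys) @ rev [Suc (length xs)..<Suc n])"

lemma canonical_word_split:
  assumes "Suc n \<notin> set xs"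
  shows "canonical_word (Suc n) (xs @ Suc n # ys) =
    canonical_word n (xs @ ys) @ rev [Suc (length xs)..<Suc n]"
proof -
  have "takeWhile (\<lambda>v. v \<noteq> Suc n) (xs @ Suc n # ys) = xs"
    "dropWhile (\<lambda>v. v \<noteq> Suc n) (xs @ Suc n # ys) = Suc n # ys"
    using assms by (induction xs) auto
  then show ?thesis by (simp add: Let_def)
qed

text \<open>Once the moves of the largest value are collected at the end, the front is an ascending
  word on the smaller values, to which induction applies.\<close>

lemma down_moves_canonical:
  assumes "set a \<subseteq> {1..<n}" "ascending a [1..<Suc n]"
  shows "(a, canonical_word n (act a [1..<Suc n])) \<in> down_moves\<^sup>*"
  using assms
proof (induction n arbitrary: a)
  case (Suc n)
  obtain b p where b: "set b \<subseteq> {1..<n}" "p \<in> {1..Suc n}"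
    "(a, b @ rev [p..<Suc n]) \<in> down_moves\<^sup>*"
    using normalize_largest[OF Suc.prems] by blast
  obtain xs ys where xy: "act b [1..<Suc n] = xs @ ys" "p = Suc (length xs)"
    "n = length xs + length ys"
    "act (b @ rev [p..<Suc n]) [1..<Suc (Suc n)] = xs @ Suc n # ys"
    using act_insert_largest[OF b(1,2)] .
  have set_a: "set a \<subseteq> {1..<length [1..<Suc (Suc n)]}" using Suc.prems by simp
  note w = down_moves_word[OF b(3) set_a]
  have "ascending b [1..<Suc (Suc n)]" using w(3) Suc.prems(2) by simp
  then have "ascending b [1..<Suc n]"
    using ascending_append_state[of b "[1..<Suc n]" "[Suc n]"] b(1)
    by (simp add: upt_1_snoc)
  then have "(b, canonical_word n (xs @ ys)) \<in> down_moves\<^sup>*"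
    using Suc.IH[OF b(1)] xy(1) by simp
  from down_moves_append[OF this, of "[]" "rev [p..<Suc n]"]
  have "(b @ rev [p..<Suc n], canonical_word n (xs @ ys) @ rev [p..<Suc n]) \<in> down_moves\<^sup>*"
    by simp
  moreover have "Suc n \<notin> set (xs @ ys)"
  proof -
    have "set b \<subseteq> {1..<length [1..<Suc n]}" using b(1) by simp
    then have "set (xs @ ys) = set [1..<Suc n]" using mset_act xy(1) mset_eq_setD by metis
    then show ?thesis by simp
  qed
  then have "canonical_word (Suc n) (act a [1..<Suc (Suc n)]) =
      canonical_word n (xs @ ys) @ rev [p..<Suc n]"
    using canonical_word_split[of n xs ys] w(2) xy by simp
  ultimately show ?case using b(3) by (simp del: canonical_word.simps)
qed simp

text \<open>Each inserted value exceeds all earlier ones, so every swap ascends and sees no larger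
  entry on its left.\<close>

lemma canonical_word_correct:
  assumes "mset w = mset [1..<Suc n]"
  shows "set (canonical_word n w) \<subseteq> {1..<n} \<and> ascending (canonical_word n w) [1..<Suc n]
    \<and> act (canonical_word n w) [1..<Suc n] = w \<and> antilex (canonical_word n w) [1..<Suc n] = 0"
  using assms
proof (induction n arbitrary: w)
  case (Suc n)
  note id = upt_1_snoc[of n]
  have "Suc n \<in> set w" using mset_eq_setD[OF Suc.prems] by simp
  then obtain xs ys where w: "w = xs @ Suc n # ys" "Suc n \<notin> set xs"
    by (meson split_list_first)
  have m: "mset (xs @ ys) = mset [1..<Suc n]"
    using Suc.prems unfolding id w(1) by simp
  have set_xy: "set xs \<union> set ys = {1..n}"
    using mset_eq_setD[OF m] by (simp add: atLeastLessThanSuc_atLeastAtMost)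
  have len: "n = length xs + length ys" using mset_eq_length[OF m] by simp
  define c where "c = canonical_word n (xs @ ys)"
  note IH = Suc.IH[OF m, folded c_def]
  have c: "set c \<subseteq> {1..<length [1..<Suc n]}" using IH by simp
  have cw: "canonical_word (Suc n) (xs @ Suc n # ys) = c @ rev [Suc (length xs)..<Suc n]"
    unfolding canonical_word_split[OF w(2)] c_def ..
  have act_c: "act c [1..<Suc (Suc n)] = xs @ ys @ [Suc n]"
    unfolding id act_append_state[OF c] using IH by simp
  have "ascending c [1..<Suc (Suc n)]" "antilex c [1..<Suc (Suc n)] = 0"
    unfolding id ascending_append_state[OF c] antilex_append_state[OF c] using IH by auto
  moreover have le: "y \<le> n" if "y \<in> set xs \<union> set ys" for y
    using that unfolding set_xy by simp
  moreover have "ascending (rev [Suc (length xs)..<Suc n]) (xs @ ys @ [Suc n])"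
    using ascending_rev_upt[of ys "Suc n" xs "[]"] le unfolding len[symmetric]
    by (simp add: le_imp_less_Suc)
  moreover have "antilex (rev [Suc (length xs)..<Suc n]) (xs @ ys @ [Suc n]) = 0"
    using antilex_rev_upt[of xs ys "Suc n" "[]"] le unfolding len[symmetric]
    by (simp add: le_SucI)
  moreover have "act (rev [Suc (length xs)..<Suc n]) (xs @ ys @ [Suc n]) = xs @ Suc n # ys"
    using act_rev_upt[of xs ys "Suc n" "[]"] unfolding len[symmetric] by simp
  moreover have "set (c @ rev [Suc (length xs)..<Suc n]) \<subseteq> {1..<Suc n}"
    using c by auto
  ultimately show ?case
    unfolding w(1) cw act_append ascending_append antilex_append act_c by simp
qed simp

section \<open>The symmetry exchanging the two orders\<close>

definition reflect_word :: "nat \<Rightarrow> nat list \<Rightarrow> nat list" where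
  "reflect_word n a = map (\<lambda>i. n - i) a"

text \<open>Conjugation by the longest permutation. Reversing positions takes the pair
  \<open>i\<close>, \<open>i + 1\<close> to \<open>n - i\<close>, \<open>n - i + 1\<close>, which
  explains the letters in \<open>reflect_word\<close>.\<close>

definition reflect_perm :: "nat \<Rightarrow> nat list \<Rightarrow> nat list" where
  "reflect_perm n u = map (\<lambda>v. Suc n - v) (rev u)"

lemma reflect_word_invol: "set a \<subseteq> {1..<n} \<Longrightarrow> reflect_word n (reflect_word n a) = a"
  unfolding reflect_word_def by (induction a) auto

lemma set_reflect_word: "set a \<subseteq> {1..<n} \<Longrightarrow> set (reflect_word n a) \<subseteq> {1..<n}"
  unfolding reflect_word_def by (force simp: subset_iff)

lemma reflect_perm_invol: "set u \<subseteq> {1..n} \<Longrightarrow> reflect_perm n (reflect_perm n u) = u"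
  unfolding reflect_perm_def rev_map rev_rev_ident map_map
  by (rule map_idI) auto

lemma reflect_perm_id: "reflect_perm n [1..<Suc n] = [1..<Suc n]"
  unfolding reflect_perm_def by (rule nth_equalityI) (auto simp: rev_nth)

text \<open>Reversal and complement together preserve ascents, while a smaller entry to the right
  becomes a larger entry to the left.\<close>

lemma reflect_act:
  assumes "set a \<subseteq> {1..<n}" "length u = n" "set u \<subseteq> {1..n}"
  shows "act (reflect_word n a) (reflect_perm n u) = reflect_perm n (act a u)
    \<and> ascending (reflect_word n a) (reflect_perm n u) = ascending a u
    \<and> antilex (reflect_word n a) (reflect_perm n u) = lex_triples a u"
  using assms
proof (induction a arbitrary: u)
  case Nil
  then show ?case by (simp add: reflect_word_def)
next
  case (Cons i a)
  then have "i \<in> {1..<length u}" by simp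
  then obtain xs x y ys where u: "u = xs @ x # y # ys" "i = Suc (length xs)"
    by (rule split_at_two)
  let ?r = "\<lambda>v. Suc n - v"
  have n: "n - i = Suc (length (reflect_perm n ys))"
    using Cons.prems u by (auto simp: reflect_perm_def)
  have r1: "reflect_perm n u = reflect_perm n ys @ ?r y # ?r x # reflect_perm n xs"
    and r2: "reflect_perm n (xs @ y # x # ys)
      = reflect_perm n ys @ ?r x # ?r y # reflect_perm n xs"
    unfolding u reflect_perm_def by auto
  have w: "reflect_word n (i # a) = Suc (length (reflect_perm n ys)) # reflect_word n a"
    using n by (simp add: reflect_word_def)
  have le: "x \<le> n" "y \<le> n" using Cons.prems u by auto
  have asc: "?r y < ?r x \<longleftrightarrow> x < y" using le by auto
  have "length (filter (\<lambda>v. ?r y < v \<and> ?r x < v) (reflect_perm n ys))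
    = length (filter (\<lambda>v. v < x \<and> v < y) ys)"
  proof -
    have "(?r y < ?r v \<and> ?r x < ?r v) \<longleftrightarrow> (v < x \<and> v < y)" for v using le by auto
    then have "((\<lambda>v. ?r y < v \<and> ?r x < v) \<circ> ?r) = (\<lambda>v. v < x \<and> v < y)"
      by (auto simp: fun_eq_iff)
    then show ?thesis
      unfolding reflect_perm_def filter_map length_map rev_filter[symmetric] length_rev
      by simp
  qed
  then show ?case
    using Cons.IH[of "xs @ y # x # ys"] Cons.prems asc
    unfolding w r1 r2 unfolding u by simp
qed

lemma reflect_down_moves:
  assumes "(a, b) \<in> down_moves\<^sup>*" "set a \<subseteq> {1..<n}"
  shows "(reflect_word n b, reflect_word n a) \<in> down_moves\<^sup>*"
  using assms(1)
proof (induction rule: rtrancl_induct)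
  case (step b c)
  \<comment> \<open>The list \<open>replicate n ()\<close> is a dummy state whose length supplies
    the bound on the letters.\<close>
  have b: "set b \<subseteq> {1..<n}"
    using down_moves_word(1)[OF step.hyps(1), of "replicate n ()"] assms(2) by simp
  from step.hyps(2) have "(reflect_word n c, reflect_word n b) \<in> down_moves"
  proof
    assume "(b, c) \<in> commutation"
    then obtain xs i j ys where *: "b = xs @ i # j # ys" "c = xs @ j # i # ys" "far i j"
      by (rule commutationE)
    then have "far (n - j) (n - i)" using b by (auto split: if_splits)
    then show ?thesis
      using commutation_swap[of "n - j" "n - i"] * by (simp add: reflect_word_def)
  next
    assume "(b, c) \<in> braid_down"
    then obtain xs i ys where *: "b = xs @ Suc i # i # Suc i # ys" "c = xs @ i # Suc i # i # ys"
      by (rule braid_downE)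
    then have "Suc i < n" using b by auto
    \<comment> \<open>The smaller of the two braid letters becomes the larger one, so the
      orientation of the braid is reversed.\<close>
    then have "n - i = Suc (n - Suc i)" by simp
    then have "reflect_word n c =
        reflect_word n xs @ [Suc (n - Suc i), n - Suc i, Suc (n - Suc i)] @ reflect_word n ys"
      "reflect_word n b =
        reflect_word n xs @ [n - Suc i, Suc (n - Suc i), n - Suc i] @ reflect_word n ys"
      using * by (simp_all add: reflect_word_def)
    then show ?thesis unfolding braid_down_def by blast
  qed
  from converse_rtrancl_into_rtrancl[OF this step.IH] show ?case .
qed simp

section \<open>The extremal reduced words\<close>

lemma is_perm_mset: "is_perm n w \<longleftrightarrow> mset w = mset [1..<Suc n]"
proof
  assume "is_perm n w"
  then have "distinct w" "set w = set [1..<Suc n]"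
    by (simp_all add: is_perm_def atLeastLessThanSuc_atLeastAtMost)
  then show "mset w = mset [1..<Suc n]"
    using set_eq_iff_mset_eq_distinct[of w "[1..<Suc n]"] by (simp only: distinct_upt)
next
  assume m: "mset w = mset [1..<Suc n]"
  then have "length w = n" "set w = set [1..<Suc n]" "distinct w"
    using mset_eq_length[OF m] mset_eq_setD[OF m] mset_eq_imp_distinct_iff[OF m]
    by (simp_all del: mset_upt)
  then show "is_perm n w"
    by (simp add: is_perm_def atLeastLessThanSuc_atLeastAtMost)
qed

lemma is_perm_reflect: "is_perm n w \<Longrightarrow> is_perm n (reflect_perm n w)"
  unfolding is_perm_def reflect_perm_def
proof (intro conjI; elim conjE)
  assume w: "set w = {1..n}" "distinct w"
  show "distinct (map (\<lambda>v. Suc n - v) (rev w))"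
    using w by (auto simp: distinct_map inj_on_def)
  show "set (map (\<lambda>v. Suc n - v) (rev w)) = {1..n}"
  proof -
    have "(\<lambda>v. Suc n - v) ` {1..n} = {1..n}"
    proof (intro equalityI subsetI)
      fix v assume "v \<in> {1..n}"
      then have "v = Suc n - (Suc n - v)" "Suc n - v \<in> {1..n}" by auto
      then show "v \<in> (\<lambda>v. Suc n - v) ` {1..n}" by blast
    qed auto
    then show ?thesis using w by simp
  qed
qed simp

lemma bottom_word:
  assumes "is_perm n w"
  obtains d where "d \<in> reduced_words n w" "antilex d [1..<Suc n] = 0"
    "\<And>a. a \<in> reduced_words n w \<Longrightarrow> (a, d) \<in> down_moves\<^sup>*"
proof
  let ?d = "canonical_word n w"
  show "?d \<in> reduced_words n w" "antilex ?d [1..<Suc n] = 0"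
    using canonical_word_correct[of w n] assms
    by (auto simp: is_perm_mset reduced_words_iff)
  show "(a, ?d) \<in> down_moves\<^sup>*" if "a \<in> reduced_words n w" for a
    using down_moves_canonical[of a n] that by (auto simp: reduced_words_iff)
qed

lemma reflect_reduced:
  assumes "a \<in> reduced_words n w"
  shows "reflect_word n a \<in> reduced_words n (reflect_perm n w)"
proof -
  have "{1..<Suc n} \<subseteq> {1..n}" by auto
  then show ?thesis
    using assms reflect_act[of a n "[1..<Suc n]"] set_reflect_word[of a n]
    by (simp add: reduced_words_iff reflect_perm_id)
qed

text \<open>Reflect the bottom word of the reflected permutation. Reflection reverses downward
  moves, so a common endpoint becomes a common starting point.\<close>

lemma top_word:
  assumes "is_perm n w"
  obtains e where "e \<in> reduced_words n w" "lex_triples e [1..<Suc n] = 0"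
    "\<And>a. a \<in> reduced_words n w \<Longrightarrow> (e, a) \<in> down_moves\<^sup>*"
proof -
  obtain d where d: "d \<in> reduced_words n (reflect_perm n w)" "antilex d [1..<Suc n] = 0"
    "\<And>a. a \<in> reduced_words n (reflect_perm n w) \<Longrightarrow> (a, d) \<in> down_moves\<^sup>*"
    using bottom_word[OF is_perm_reflect[OF assms]] by blast
  let ?e = "reflect_word n d"
  have inv: "reflect_perm n (reflect_perm n w) = w"
    using assms by (intro reflect_perm_invol) (auto simp: is_perm_def)
  have set_d: "set d \<subseteq> {1..<n}" using d(1) by (simp add: reduced_words_iff)
  show thesis
  proof
    show "?e \<in> reduced_words n w" using reflect_reduced[OF d(1)] inv by simp
    show "lex_triples ?e [1..<Suc n] = 0"
      using reflect_act[OF set_reflect_word[OF set_d], of "[1..<Suc n]"] d(2)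
      by (simp add: reflect_perm_id reflect_word_invol[OF set_d] subset_iff)
    show "(?e, a) \<in> down_moves\<^sup>*" if a: "a \<in> reduced_words n w" for a
    proof -
      have set_a: "set a \<subseteq> {1..<n}" using a by (simp add: reduced_words_iff)
      from reflect_down_moves[OF d(3)[OF reflect_reduced[OF a]] set_reflect_word[OF set_a]]
      show ?thesis by (simp only: reflect_word_invol[OF set_a])
    qed
  qed
qed

section \<open>Distances in the commutation graph\<close>

abbreviation cg_rel :: "nat \<Rightarrow> nat list \<Rightarrow> (nat list set \<times> nat list set) set" where
  "cg_rel n w \<equiv> {(A, B). cg_edge n w A B}"

text \<open>Powers of a relation make concatenating and reversing walks easy. That \<open>A\<close>
  is a vertex matters for \<open>k = 0\<close>, where no edge guarantees it.\<close>

lemma cg_walk_relpow: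
  assumes "A \<in> cg_vertices n w"
  shows "(\<exists>ps. cg_walk n w ps \<and> hd ps = A \<and> last ps = B \<and> length ps = Suc k) \<longleftrightarrow>
    (A, B) \<in> cg_rel n w ^^ k"
proof
  assume "\<exists>ps. cg_walk n w ps \<and> hd ps = A \<and> last ps = B \<and> length ps = Suc k"
  then obtain ps where ps: "cg_walk n w ps" "hd ps = A" "last ps = B" "length ps = Suc k" by blast
  then have "ps ! 0 = A" "ps ! k = B"
    by (auto simp: hd_conv_nth last_conv_nth cg_walk_def)
  with ps show "(A, B) \<in> cg_rel n w ^^ k"
    by (auto simp: relpow_fun_conv cg_walk_def intro!: exI[of _ "(!) ps"])
next
  assume "(A, B) \<in> cg_rel n w ^^ k"
  then obtain f where f: "f 0 = A" "f k = B" "\<forall>i<k. cg_edge n w (f i) (f (Suc i))"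
    by (auto simp: relpow_fun_conv)
  let ?ps = "map f [0..<Suc k]"
  have "f i \<in> cg_vertices n w" if "i \<le> k" for i
    using that f assms by (cases i) (auto simp: cg_edge_def)
  then have "cg_walk n w ?ps"
    using f by (auto simp: cg_walk_def)
  moreover have "hd ?ps = A" "last ?ps = B" using f by (simp_all add: hd_map last_map)
  ultimately show "\<exists>ps. cg_walk n w ps \<and> hd ps = A \<and> last ps = B \<and> length ps = Suc k"
    by (intro exI[of _ ?ps]) auto
qed

lemma cg_dist_relpow:
  "A \<in> cg_vertices n w \<Longrightarrow> cg_dist n w A B = (LEAST k. (A, B) \<in> cg_rel n w ^^ k)"
  unfolding cg_dist_def by (simp only: cg_walk_relpow)

lemma cg_rel_sym: "(A, B) \<in> cg_rel n w ^^ k \<Longrightarrow> (B, A) \<in> cg_rel n w ^^ k"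
proof (induction k arbitrary: B)
  case (Suc k)
  then obtain C where "(A, C) \<in> cg_rel n w ^^ k" "(C, B) \<in> cg_rel n w" by auto
  moreover from this have "(B, C) \<in> cg_rel n w"
    by (auto simp: cg_edge_def long_braid_iff)
  ultimately show ?case using Suc.IH relpow_Suc_I2 by metis
qed simp

lemma comm_class_eq:
  assumes "(a, b) \<in> commutation"
  shows "comm_class n w a = comm_class n w b"
proof -
  have "(a, c) \<in> commutation\<^sup>* \<longleftrightarrow> (b, c) \<in> commutation\<^sup>*" for c
    using assms commutation_sym[OF assms] by (meson converse_rtrancl_into_rtrancl)
  then show ?thesis unfolding comm_class_def by simp
qed

lemma reduced_words_down_moves:
  assumes "a \<in> reduced_words n w" "(a, b) \<in> down_moves\<^sup>*"
  shows "b \<in> reduced_words n w"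
  using down_moves_word[OF assms(2), of "[1..<Suc n]"] assms(1)
  by (auto simp: reduced_words_iff)

text \<open>Commutations keep both class and rank; each downward braid lowers the rank by one and
  uses at most one edge.\<close>

lemma down_moves_path:
  assumes "(a, b) \<in> down_moves\<^sup>*" "a \<in> reduced_words n w"
  shows "\<exists>k. (comm_class n w a, comm_class n w b) \<in> cg_rel n w ^^ k
    \<and> antilex b [1..<Suc n] + k \<le> antilex a [1..<Suc n]"
  using assms(1)
proof (induction rule: rtrancl_induct)
  case base
  show ?case by (rule exI[of _ 0]) simp
next
  case (step b c)
  then obtain k where k: "(comm_class n w a, comm_class n w b) \<in> cg_rel n w ^^ k"
    "antilex b [1..<Suc n] + k \<le> antilex a [1..<Suc n]" by blast
  have b: "b \<in> reduced_words n w" using reduced_words_down_moves[OF assms(2) step.hyps(1)] .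
  moreover have "(b, c) \<in> down_moves\<^sup>*" using step.hyps(2) by blast
  ultimately have c: "c \<in> reduced_words n w" by (rule reduced_words_down_moves)
  have set_b: "set b \<subseteq> {1..<length [1..<Suc n]}" "ascending b [1..<Suc n]"
    using b by (auto simp: reduced_words_iff)
  from step.hyps(2) show ?case
  proof
    assume bc: "(b, c) \<in> commutation"
    show ?thesis
      using k comm_class_eq[OF bc] commutation_word(4)[OF bc set_b(1)] by metis
  next
    assume bc: "(b, c) \<in> braid_down"
    note rank = braid_down_word(4)[OF bc set_b]
    show ?thesis
    proof (cases "comm_class n w b = comm_class n w c")
      \<comment> \<open>No edge is used here although the rank drops; the inequality absorbs
        this.\<close>
      case True
      with k rank show ?thesis by (intro exI[of _ k]) auto
    next
      case False
      have "b \<in> comm_class n w b" "c \<in> comm_class n w c"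
        using b c by (auto simp: comm_class_def)
      then have "cg_edge n w (comm_class n w b) (comm_class n w c)"
        using False b c bc by (auto simp: cg_edge_def cg_vertices_def long_braid_iff)
      then have "(comm_class n w a, comm_class n w c) \<in> cg_rel n w ^^ Suc k"
        using k(1) by auto
      with k rank show ?thesis by (intro exI[of _ "Suc k"]) auto
    qed
  qed
qed

section \<open>The rank as a lower bound for distances\<close>

lemma antilex_commutation:
  assumes "(a, b) \<in> commutation\<^sup>*" "set a \<subseteq> {1..<length u}"
  shows "antilex b u = antilex a u"
proof -
  from assms(1) have "set b = set a \<and> antilex b u = antilex a u"
  proof (induction rule: rtrancl_induct)
    case (step b c)
    from commutation_word[OF step.hyps(2), of u] show ?case using step.IH assms(2) by simp
  qed simp
  then show ?thesis ..
qed

text \<open>Makes the rank a function on the vertices of the graph.\<close>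

lemma antilex_class:
  assumes "A \<in> cg_vertices n w" "a \<in> A" "b \<in> A"
  shows "antilex a [1..<Suc n] = antilex b [1..<Suc n]"
proof -
  obtain c where "c \<in> reduced_words n w" "A = comm_class n w c"
    using assms(1) by (auto simp: cg_vertices_def)
  then have "set c \<subseteq> {1..<length [1..<Suc n]}" "(c, a) \<in> commutation\<^sup>*" "(c, b) \<in> commutation\<^sup>*"
    using assms(2,3) by (simp_all add: comm_class_def reduced_words_iff)
  then show ?thesis using antilex_commutation by metis
qed

lemma antilex_edge:
  assumes "cg_edge n w A B" "a \<in> A" "b \<in> B"
  shows "antilex a [1..<Suc n] \<le> Suc (antilex b [1..<Suc n])"
proof -
  obtain a' b' where *: "A \<in> cg_vertices n w" "B \<in> cg_vertices n w" "a' \<in> A" "b' \<in> B"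
    "(a', b') \<in> long_braid"
    using assms(1) by (auto simp: cg_edge_def)
  then have "a' \<in> reduced_words n w" "b' \<in> reduced_words n w"
    by (auto simp: cg_vertices_def comm_class_def)
  then have r: "set a' \<subseteq> {1..<length [1..<Suc n]}" "ascending a' [1..<Suc n]"
    "set b' \<subseteq> {1..<length [1..<Suc n]}" "ascending b' [1..<Suc n]"
    by (simp_all add: reduced_words_iff)
  from *(5) have "antilex a' [1..<Suc n] \<le> Suc (antilex b' [1..<Suc n])"
    unfolding long_braid_iff
  proof
    assume "(a', b') \<in> braid_down"
    from braid_down_word(4)[OF this r(1,2)] show ?thesis by simp
  next
    assume "(b', a') \<in> braid_down"
    from braid_down_word(4)[OF this r(3,4)] show ?thesis by simp
  qed
  then show ?thesis
    using antilex_class[OF *(1) assms(2) *(3)] antilex_class[OF *(2) assms(3) *(4)] by simp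
qed

text \<open>The rank falls by at most one along each edge, so a drop in rank bounds the number of
  edges from below.\<close>

lemma antilex_relpow:
  assumes "(A, B) \<in> cg_rel n w ^^ k" "A \<in> cg_vertices n w" "a \<in> A" "b \<in> B"
  shows "antilex a [1..<Suc n] \<le> antilex b [1..<Suc n] + k"
  using assms
proof (induction k arbitrary: B b)
  case 0
  then show ?case using antilex_class[of A n w a b] by simp
next
  case (Suc k)
  then obtain C where C: "(A, C) \<in> cg_rel n w ^^ k" "cg_edge n w C B" by auto
  then obtain c where "c \<in> C" by (auto simp: cg_edge_def)
  then show ?case
    using Suc.IH[OF C(1) Suc.prems(2,3)] antilex_edge[OF C(2) _ Suc.prems(4)] by fastforce
qed

theorem mainTheorem1:
  fixes n :: nat and w :: "nat list"
  assumes "2 \<le> n" and "is_perm n w"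
  shows "cg_diameter n w = card (T321 w)"
proof -
  let ?A = "\<lambda>a. antilex a [1..<Suc n]" and ?C = "comm_class n w"
  let ?T = "card (T321 w)"
  obtain d where d: "d \<in> reduced_words n w" "?A d = 0"
    "\<And>a. a \<in> reduced_words n w \<Longrightarrow> (a, d) \<in> down_moves\<^sup>*"
    using bottom_word[OF assms(2)] by blast
  obtain e where e: "e \<in> reduced_words n w" "lex_triples e [1..<Suc n] = 0"
    "\<And>a. a \<in> reduced_words n w \<Longrightarrow> (e, a) \<in> down_moves\<^sup>*"
    using top_word[OF assms(2)] by blast
  have T: "?T = ?A a + lex_triples a [1..<Suc n]" if "a \<in> reduced_words n w" for a
    using card_T321_act[of "[1..<Suc n]" a] T321_upt[of 1 "Suc n"] that
    by (auto simp: reduced_words_iff simp del: T321_upt)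
  have Ae: "?A e = ?T" using T[OF e(1)] e(2) by simp
  have near: "\<exists>k\<le>?T. (?C a, ?C b) \<in> cg_rel n w ^^ k"
    if a: "a \<in> reduced_words n w" and b: "b \<in> reduced_words n w" for a b
  proof (cases "?A a + ?A b \<le> ?T")
    case True
    \<comment> \<open>Route through the bottom class, of length at most the sum of the two
      ranks.\<close>
    obtain k l where "(?C a, ?C d) \<in> cg_rel n w ^^ k" "k \<le> ?A a"
      "(?C b, ?C d) \<in> cg_rel n w ^^ l" "l \<le> ?A b"
      using down_moves_path[OF d(3)[OF a] a] down_moves_path[OF d(3)[OF b] b] d(2) by auto
    moreover from this have "(?C a, ?C b) \<in> cg_rel n w ^^ (k + l)"
      unfolding relpow_add by (meson cg_rel_sym relcompI)
    ultimately show ?thesis using True by (intro exI[of _ "k + l"]) auto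
  next
    case False
    \<comment> \<open>Route through the top class, of length at most \<open>2 * ?T\<close> minus the
      sum of the ranks, which now exceeds \<open>?T\<close>.\<close>
    obtain k l where "(?C e, ?C a) \<in> cg_rel n w ^^ k" "?A a + k \<le> ?T"
      "(?C e, ?C b) \<in> cg_rel n w ^^ l" "?A b + l \<le> ?T"
      using down_moves_path[OF e(3)[OF a] e(1)] down_moves_path[OF e(3)[OF b] e(1)] Ae by auto
    moreover from this have "(?C a, ?C b) \<in> cg_rel n w ^^ (k + l)"
      unfolding relpow_add by (meson cg_rel_sym relcompI)
    ultimately show ?thesis using False by (intro exI[of _ "k + l"]) auto
  qed
  let ?D = "{cg_dist n w A B | A B. A \<in> cg_vertices n w \<and> B \<in> cg_vertices n w}"
  have le: "cg_dist n w A B \<le> ?T" if AB: "A \<in> cg_vertices n w" "B \<in> cg_vertices n w" for A B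
  proof -
    obtain k where "k \<le> ?T" "(A, B) \<in> cg_rel n w ^^ k"
      using AB near by (auto simp: cg_vertices_def)
    then show ?thesis
      unfolding cg_dist_relpow[OF AB(1)] by (meson Least_le le_trans)
  qed
  have V: "?C e \<in> cg_vertices n w" "?C d \<in> cg_vertices n w"
    using d(1) e(1) by (auto simp: cg_vertices_def)
  obtain k where "(?C e, ?C d) \<in> cg_rel n w ^^ k" using near[OF e(1) d(1)] by blast
  \<comment> \<open>Some connecting chain exists, so the minimum defining the distance is
    attained.\<close>
  then have "(?C e, ?C d) \<in> cg_rel n w ^^ cg_dist n w (?C e) (?C d)"
    unfolding cg_dist_relpow[OF V(1)] by (rule LeastI)
  moreover have "e \<in> ?C e" "d \<in> ?C d" using d(1) e(1) by (auto simp: comm_class_def)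
  \<comment> \<open>The rank falls from \<open>?T\<close> at the top to \<open>0\<close> at the
    bottom.\<close>
  ultimately have "?T \<le> cg_dist n w (?C e) (?C d)"
    using antilex_relpow[OF _ V(1), of "?C d" _ e d] d(2) Ae by simp
  then have "cg_dist n w (?C e) (?C d) = ?T" using le[OF V] by simp
  then have "?T \<in> ?D" using V by (metis (mono_tags, lifting) mem_Collect_eq)
  moreover have "finite ?D" by (rule finite_subset[of _ "{..?T}"]) (use le in auto)
  ultimately show ?thesis
    unfolding cg_diameter_def using le by (intro Max_eqI) auto
qed

end
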